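(* Let $N=2^r$ with $r\ge 1$, let $Q\ge 1$ be the number of elements, with element sizes $\Delta x_q>0$, and let $f$ be a flux function and $f^*$ a consistent numerical two-point flux. For arbitrary blending factors $\alpha_q\in\mathbb{R}$, $q=1,\dots,Q$, the single-level blended scheme $$\partial_t \bar{u}_q=(1-\alpha_q)\,\frac{-N}{\Delta x_q}\,\Delta\, f^*_q+\alpha_q\,\frac{1}{\Delta x_q}\left(\hat D\,\tilde f_q-\hat B\, f_q^*\right),\qquad q=1,\dots,Q,$$ (with all operators and vectors as defined in the context) is conservative. That is, for arbitrary mean values $\bar u_q\in\mathbb{R}^N$, the discrete integral of the right-hand sides involves only the numerical fluxes at the two physical boundary interfaces: $$\sum_{q=1}^{Q}\Delta x_q\,\mathbf{1}^T\partial_t\bar u_q=-N\left(-(f^*_1)_1+(f^*_Q)_{N+1}\right),$$ and these cancel to zero in the case of periodic boundary conditions. Here $\mathbf 1=(1,\dots,1)^T\in\mathbb{R}^N$, and $(f_q^* )_i$ denotes the $i$-th entry of $f_q^*\in\mathbb{R}^{N+1}$.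
   Context: The scheme approximates the 1D conservation law $\partial_t u+\partial_x f(u)=0$, with $f:\mathbb{R}\to\mathbb{R}$, on a domain divided into $Q$ consecutive non-overlapping elements. Each element $q$ carries $N$ mean values $\bar u_q=((\bar u_1)_q,\dots,(\bar u_N)_q)^T\in\mathbb{R}^N$ on a uniform subcell grid. The numerical flux $f^*:\mathbb{R}\times\mathbb{R}\to\mathbb{R}$ is consistent: $f^*(u,u)=f(u)$. In the scheme, $\partial_t\bar u_q$ denotes the right-hand side determined by the current mean values. **Quadrature and Lagrange basis.** The reference element is $[-\tfrac12,\tfrac12]$. Let $\xi_1,\dots,\xi_N$ be the Gauss-Legendre nodes on $[-\tfrac12,\tfrac12]$ with associated quadrature weights $\omega_1,\dots,\omega_N$, and let $\ell_i(\xi)=\prod_{k\ne i}\frac{\xi-\xi_k}{\xi_i-\xi_k}$ be the Lagrange polynomials. **FV difference matrix.** $\Delta\in\mathbb{R}^{N\times(N+1)}$ has entries $\Delta_{ii}=-1$, $\Delta_{i,i+1}=1$, and zero otherwise. **DG operators.** Let $\mathcal M=\mathrm{diag}(\omega_1,\dots,\omega_N)$ and $\mathcal D_{ij}=\ell_j'(\xi_i)$, and set $D=\mathcal M^{-1}\mathcal D^T\mathcal M\in\mathbb{R}^{N\times N}$. The matrix $B^{(0)}\in\mathbb{R}^{N\times(N+1)}$ has first column $-\ell_i(-\tfrac12)/\omega_i$ and last column $\ell_i(\tfrac12)/\omega_i$ ($i=1,\dots,N$), and all other columns zero. **Projection and reconstruction.** With $\mu_{i\pm1/2}=-\tfrac12+\tfrac{i}{N}-\tfrac{1}{2N}\pm\tfrac{1}{2N}$,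 the projection matrix $P\in\mathbb{R}^{N\times N}$ is $P_{ij}=N\int_{\mu_{i-1/2}}^{\mu_{i+1/2}}\ell_j(\xi)\,d\xi$. It is nonsingular and $R=P^{-1}$. Set $\hat D=PD$ and $\hat B=PB^{(0)}$. The nodal values are reconstructed from the mean values by $\tilde u_q=R^{(\beta_q)}\bar u_q$, where $R^{(\beta)}=\frac{1-\beta}{N}\mathbf 1\mathbf 1^T+\beta R$ and $\beta_q\in[0,1]$ is a limiting parameter ($\beta_q=1$ meaning no limiting). The DG volume flux is $\tilde f_q=(f((\tilde u_1)_q),\dots,f((\tilde u_N)_q))^T$. **Common surface flux.** Let $\tilde u_q^{\pm}=\sum_{i=1}^N\ell_i(\pm\tfrac12)(\tilde u_i)_q$ and, for each element $q$, $$u^-_{q-1/2}=(1-\alpha_q)(\bar u_1)_q+\alpha_q\tilde u_q^-,\qquad u^+_{q+1/2}=(1-\alpha_q)(\bar u_N)_q+\alpha_q\tilde u_q^+.$$ At the two domain boundaries, the remaining states $u^+_{1/2}$ and $u^-_{Q+1/2}$ are prescribed by the boundary conditions; periodic boundary conditions mean $u^+_{1/2}=u^+_{Q+1/2}$ and $u^-_{Q+1/2}=u^-_{1/2}$. Define $$u_q^+=\left(u^+_{q-1/2},(\bar u_1)_q,\dots,(\bar u_{N-1})_q,u^+_{q+1/2}\right)^T,\qquad u_q^-=\left(u^-_{q-1/2},(\bar u_2)_q,\dots,(\bar u_N)_q,u^-_{q+1/2}\right)^T$$ in $\mathbb{R}^{N+1}$. Then $f_q^*=f^*(u_q^+,u_q^-)\in\mathbb{R}^{N+1}$,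 evaluated entrywise. *)

theory Defs
  imports
    "HOL-Analysis.Analysis"
    "Jordan_Normal_Form.Gauss_Jordan_Elimination"
begin

unbundle no vec_syntax and no inner_syntax
hide_const (open) Finite_Cartesian_Product.vec Finite_Cartesian_Product.mat
  Finite_Cartesian_Product.row Finite_Cartesian_Product.rows

(* Vectors and matrices are 0-based here: the entry with index i of a vector (or the
   i-th node, weight, subcell, ...) is the one with index i + 1 in the usual 1-based
   notation.  Elements keep their 1-based numbering q = 1, ..., Q. *)

section \<open>Gauss-Legendre quadrature and Lagrange basis on [-1/2, 1/2]\<close>

(* Rodrigues' formula *)
definition legendre :: "nat \<Rightarrow> real poly" where
  "legendre n = Polynomial.smult (1 / (2 ^ n * fact n)) ((pderiv ^^ n) ([:-1, 0, 1:] ^ n))"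

definition gl_node :: "nat \<Rightarrow> nat \<Rightarrow> real" where
  "gl_node N i = sorted_list_of_set {x. poly (legendre N) (2 * x) = 0} ! i"

definition lagrange :: "nat \<Rightarrow> nat \<Rightarrow> real poly" where
  "lagrange N i = (\<Prod>k \<in> {..<N} - {i}.
     Polynomial.smult (1 / (gl_node N i - gl_node N k)) [:- gl_node N k, 1:])"

definition gl_weight :: "nat \<Rightarrow> nat \<Rightarrow> real" where
  "gl_weight N i = integral {-1/2..1/2} (poly (lagrange N i))"

section \<open>Operators\<close>

definition inv_mat :: "real mat \<Rightarrow> real mat" where
  "inv_mat A = the (mat_inverse A)"

definition ones :: "nat \<Rightarrow> real vec" where
  "ones N = vec N (\<lambda>_. 1)"

definition fv_diff :: "nat \<Rightarrow> real mat" where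
  "fv_diff N = mat N (N + 1) (\<lambda>(i, j). if j = i then -1 else if j = i + 1 then 1 else 0)"

definition mass_mat :: "nat \<Rightarrow> real mat" where
  "mass_mat N = mat_diag N (gl_weight N)"

definition nodal_diff :: "nat \<Rightarrow> real mat" where
  "nodal_diff N = mat N N (\<lambda>(i, j). poly (pderiv (lagrange N j)) (gl_node N i))"

definition dg_vol :: "nat \<Rightarrow> real mat" where
  "dg_vol N = inv_mat (mass_mat N) * transpose_mat (nodal_diff N) * mass_mat N"

definition dg_surf :: "nat \<Rightarrow> real mat" where
  "dg_surf N = mat N (N + 1) (\<lambda>(i, j).
     if j = 0 then - poly (lagrange N i) (-1/2) / gl_weight N i
     else if j = N then poly (lagrange N i) (1/2) / gl_weight N i
     else 0)"

(* Subcell with 0-based index i is [subcell_face N i, subcell_face N (i + 1)]. *)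
definition subcell_face :: "nat \<Rightarrow> nat \<Rightarrow> real" where
  "subcell_face N i = -1/2 + real i / real N"

definition proj_mat :: "nat \<Rightarrow> real mat" where
  "proj_mat N = mat N N (\<lambda>(i, j).
     real N * integral {subcell_face N i..subcell_face N (i + 1)} (poly (lagrange N j)))"

definition rec_mat :: "nat \<Rightarrow> real mat" where
  "rec_mat N = inv_mat (proj_mat N)"

definition limited_rec_mat :: "nat \<Rightarrow> real \<Rightarrow> real mat" where
  "limited_rec_mat N b =
     ((1 - b) / real N) \<cdot>\<^sub>m (mat_of_cols N [ones N] * mat_of_rows N [ones N])
     + b \<cdot>\<^sub>m rec_mat N"

definition D_hat :: "nat \<Rightarrow> real mat" where
  "D_hat N = proj_mat N * dg_vol N"

definition B_hat :: "nat \<Rightarrow> real mat" where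
  "B_hat N = proj_mat N * dg_surf N"

section \<open>The blended scheme\<close>

definition consistent_flux :: "(real \<Rightarrow> real) \<Rightarrow> (real \<Rightarrow> real \<Rightarrow> real) \<Rightarrow> bool" where
  "consistent_flux f fs \<longleftrightarrow> (\<forall>u. fs u u = f u)"

definition nodal_values :: "nat \<Rightarrow> real \<Rightarrow> real vec \<Rightarrow> real vec" where
  "nodal_values N b u = limited_rec_mat N b *\<^sub>v u"

definition extrapolate :: "nat \<Rightarrow> real \<Rightarrow> real vec \<Rightarrow> real \<Rightarrow> real" where
  "extrapolate N b u x = (\<Sum>i<N. poly (lagrange N i) x * nodal_values N b u $ i)"

(* In the following, a and b are the blending factor and the limiting parameter of the
   element; left_trace is its u^- at the left face, right_trace its u^+ at the right face. *)
definition left_trace :: "nat \<Rightarrow> real \<Rightarrow> real \<Rightarrow> real vec \<Rightarrow> real" where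
  "left_trace N a b u = (1 - a) * u $ 0 + a * extrapolate N b u (-1/2)"

definition right_trace :: "nat \<Rightarrow> real \<Rightarrow> real \<Rightarrow> real vec \<Rightarrow> real" where
  "right_trace N a b u = (1 - a) * u $ (N - 1) + a * extrapolate N b u (1/2)"

(* face_plus ... q and face_minus ... q are the states u^+ and u^- at the interface q + 1/2,
   for q = 0, ..., Q; uL and uR are the prescribed u^+ at 1/2 and u^- at Q + 1/2. *)
definition face_plus ::
    "nat \<Rightarrow> (nat \<Rightarrow> real) \<Rightarrow> (nat \<Rightarrow> real) \<Rightarrow> real \<Rightarrow> (nat \<Rightarrow> real vec) \<Rightarrow> nat \<Rightarrow> real" where
  "face_plus N \<alpha> \<beta> uL u q = (if q = 0 then uL else right_trace N (\<alpha> q) (\<beta> q) (u q))"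

definition face_minus ::
    "nat \<Rightarrow> nat \<Rightarrow> (nat \<Rightarrow> real) \<Rightarrow> (nat \<Rightarrow> real) \<Rightarrow> real \<Rightarrow> (nat \<Rightarrow> real vec) \<Rightarrow> nat \<Rightarrow> real" where
  "face_minus N Q \<alpha> \<beta> uR u q =
     (if q = Q then uR else left_trace N (\<alpha> (q + 1)) (\<beta> (q + 1)) (u (q + 1)))"

definition states_plus ::
    "nat \<Rightarrow> (nat \<Rightarrow> real) \<Rightarrow> (nat \<Rightarrow> real) \<Rightarrow> real \<Rightarrow> (nat \<Rightarrow> real vec) \<Rightarrow> nat \<Rightarrow> real vec" where
  "states_plus N \<alpha> \<beta> uL u q = vec (N + 1) (\<lambda>j.
     if j = 0 then face_plus N \<alpha> \<beta> uL u (q - 1)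
     else if j = N then face_plus N \<alpha> \<beta> uL u q
     else u q $ (j - 1))"

definition states_minus ::
    "nat \<Rightarrow> nat \<Rightarrow> (nat \<Rightarrow> real) \<Rightarrow> (nat \<Rightarrow> real) \<Rightarrow> real \<Rightarrow> (nat \<Rightarrow> real vec) \<Rightarrow> nat \<Rightarrow> real vec" where
  "states_minus N Q \<alpha> \<beta> uR u q = vec (N + 1) (\<lambda>j.
     if j = 0 then face_minus N Q \<alpha> \<beta> uR u (q - 1)
     else if j = N then face_minus N Q \<alpha> \<beta> uR u q
     else u q $ j)"

definition surface_flux ::
    "nat \<Rightarrow> nat \<Rightarrow> (real \<Rightarrow> real \<Rightarrow> real) \<Rightarrow> (nat \<Rightarrow> real) \<Rightarrow> (nat \<Rightarrow> real) \<Rightarrow> real \<Rightarrow> real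
     \<Rightarrow> (nat \<Rightarrow> real vec) \<Rightarrow> nat \<Rightarrow> real vec" where
  "surface_flux N Q fs \<alpha> \<beta> uL uR u q = vec (N + 1) (\<lambda>j.
     fs (states_plus N \<alpha> \<beta> uL u q $ j) (states_minus N Q \<alpha> \<beta> uR u q $ j))"

definition volume_flux :: "nat \<Rightarrow> (real \<Rightarrow> real) \<Rightarrow> real \<Rightarrow> real vec \<Rightarrow> real vec" where
  "volume_flux N f b u = map_vec f (nodal_values N b u)"

definition blended_rhs ::
    "nat \<Rightarrow> nat \<Rightarrow> (nat \<Rightarrow> real) \<Rightarrow> (real \<Rightarrow> real) \<Rightarrow> (real \<Rightarrow> real \<Rightarrow> real)
     \<Rightarrow> (nat \<Rightarrow> real) \<Rightarrow> (nat \<Rightarrow> real) \<Rightarrow> real \<Rightarrow> real \<Rightarrow> (nat \<Rightarrow> real vec) \<Rightarrow> nat \<Rightarrow> real vec" where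
  "blended_rhs N Q dx f fs \<alpha> \<beta> uL uR u q =
     ((1 - \<alpha> q) * (- real N / dx q)) \<cdot>\<^sub>v (fv_diff N *\<^sub>v surface_flux N Q fs \<alpha> \<beta> uL uR u q)
     + (\<alpha> q * (1 / dx q)) \<cdot>\<^sub>v
         (D_hat N *\<^sub>v volume_flux N f (\<beta> q) (u q)
          - B_hat N *\<^sub>v surface_flux N Q fs \<alpha> \<beta> uL uR u q)"

end

(* Summing the rows of P gives 1^T P = N (omega_1, ..., omega_N), which cancels the factors
   1/omega_i in D and B^(0).  Since the Lagrange polynomials sum to 1, this yields
   1^T D^ = 0 and 1^T B^ = N (-1, 0, ..., 0, 1), so that the DG part and the subcell FV part
   have the same element balance, and the blended balances telescope over the elements.  This
   rests on the nodes being distinct and the weights being nonzero, both consequences of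
   properties of the Legendre polynomials.  The matrix P has to be shown nonsingular as well:
   inv_mat of a singular matrix is an unspecified matrix, possibly of the wrong dimension. *)

theory Submission
  imports Defs "Jordan_Normal_Form.Determinant"
begin

section \<open>Polynomials\<close>

lemma prod_linear_dvd:
  fixes p :: "real poly"
  assumes "finite A" and "\<And>x. x \<in> A \<Longrightarrow> poly p x = 0"
  shows "(\<Prod>x\<in>A. [:- x, 1:]) dvd p"
  using assms
proof (induction A arbitrary: p rule: finite_induct)
  case empty
  then show ?case by simp
next
  case (insert a A)
  have "[:- a, 1:] dvd p"
    using insert.prems by (simp add: poly_eq_0_iff_dvd [symmetric])
  then obtain q where q: "p = [:- a, 1:] * q"
    by (elim dvdE)
  have "poly q x = 0" if "x \<in> A" for x
  proof -
    have "(x - a) * poly q x = 0"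
      using insert.prems [of x] that by (simp add: q algebra_simps)
    then show ?thesis
      using that insert.hyps(2) by auto
  qed
  then have "(\<Prod>x\<in>A. [:- x, 1:]) dvd q"
    by (rule insert.IH)
  then show ?case
    using insert.hyps unfolding q by (simp add: mult_dvd_mono del: mult_pCons_left)
qed

lemma degree_prod_linear:
  fixes a :: "'b \<Rightarrow> real"
  shows "degree (\<Prod>k\<in>A. [:- a k, 1:]) = card A"
  by (cases "finite A") (simp_all add: degree_prod_eq_sum_degree)

text \<open>By the product rule both summands of the derivative keep \<open>q ^ m\<close>:
  differentiation lowers the multiplicity of a factor by at most one.\<close>

lemma power_dvd_pderiv:
  fixes p q :: "real poly"
  assumes "q ^ Suc m dvd p"
  shows "q ^ m dvd pderiv p"
proof -
  from assms obtain s where p: "p = q ^ Suc m * s"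
    by (elim dvdE)
  have "pderiv p = q ^ m * (q * pderiv s + Polynomial.smult (of_nat (Suc m)) (s * pderiv q))"
    by (simp only: p pderiv_mult pderiv_power_Suc) (simp add: algebra_simps)
  then show ?thesis
    by (metis dvd_triv_left)
qed

lemma power_dvd_pderiv_iterate:
  fixes p q :: "real poly"
  assumes "q ^ (m + k) dvd p"
  shows "q ^ m dvd (pderiv ^^ k) p"
  using assms
proof (induction k arbitrary: m)
  case (Suc k)
  then show ?case
    using Suc.IH [of "Suc m"] by (simp add: power_dvd_pderiv)
qed simp

lemma degree_pderiv_iterate:
  fixes p :: "real poly"
  shows "degree ((pderiv ^^ k) p) = degree p - k"
  by (induction k) (simp_all add: degree_pderiv)

section \<open>Antiderivatives and integrals of polynomials\<close>

lemma pderiv_sum: "pderiv (sum f A) = (\<Sum>x\<in>A. pderiv (f x))"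
  using higher_pderiv_sum [of 1 f A] by simp

lemma pderiv_surj:
  fixes p :: "real poly"
  obtains G where "pderiv G = p"
proof
  have "pderiv (\<Sum>i\<le>degree p. monom (coeff p i / real (Suc i)) (Suc i))
      = (\<Sum>i\<le>degree p. monom (coeff p i) i)"
    by (simp add: pderiv_sum pderiv_monom of_nat_Suc [symmetric] del: of_nat_Suc)
  then show "pderiv (\<Sum>i\<le>degree p. monom (coeff p i / real (Suc i)) (Suc i)) = p"
    by (simp add: poly_as_sum_of_monoms)
qed

lemma poly_pderiv_has_integral:
  fixes G :: "real poly"
  assumes "a \<le> b"
  shows "(poly (pderiv G) has_integral (poly G b - poly G a)) {a..b}"
proof (rule fundamental_theorem_of_calculus [OF assms])
  show "(poly G has_vector_derivative poly (pderiv G) x) (at x within {a..b})" for x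
    using poly_DERIV [of G x] has_real_derivative_iff_has_vector_derivative
      has_field_derivative_at_within by blast
qed

lemma integral_poly_pderiv:
  fixes G :: "real poly"
  shows "a \<le> b \<Longrightarrow> integral {a..b} (poly (pderiv G)) = poly G b - poly G a"
  by (intro integral_unique poly_pderiv_has_integral)

lemma poly_integrable [simp]: "poly (p :: real poly) integrable_on {a..b}"
  by (intro integrable_continuous_real continuous_intros)

section \<open>Legendre polynomials\<close>

text \<open>The linear factor at each end point divides the \<open>n\<close>-th power
  \<open>n\<close> times, and \<open>k < n\<close> differentiations leave at least one copy.\<close>

lemma rodrigues_vanishes_at_ends:
  assumes "k < n"
  shows "poly ((pderiv ^^ k) ([:-1, 0, 1:] ^ n)) (1 :: real) = 0"
    and "poly ((pderiv ^^ k) ([:-1, 0, 1:] ^ n)) (-1 :: real) = 0"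
proof -
  have *: "poly ((pderiv ^^ k) ([:-1, 0, 1:] ^ n)) c = 0"
    if "[:- c, 1:] dvd [:-1, 0, 1:]" for c :: real
  proof -
    have "[:- c, 1:] ^ (1 + k) dvd [:-1, 0, 1:] ^ n"
      using assms that by (metis Suc_leI dvd_power_same dvd_trans le_imp_power_dvd plus_1_eq_Suc)
    then have "[:- c, 1:] ^ 1 dvd (pderiv ^^ k) ([:-1, 0, 1:] ^ n)"
      by (rule power_dvd_pderiv_iterate)
    then show ?thesis
      by (simp add: poly_eq_0_iff_dvd)
  qed
  show "poly ((pderiv ^^ k) ([:-1, 0, 1:] ^ n)) (1 :: real) = 0"
    by (rule *) (simp add: poly_eq_0_iff_dvd [symmetric])
  show "poly ((pderiv ^^ k) ([:-1, 0, 1:] ^ n)) (-1 :: real) = 0"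
    by (rule *) (use poly_eq_0_iff_dvd [of "[:-1, 0, 1:]" "-1 :: real"] in simp)
qed

text \<open>By Rolle's theorem each differentiation keeps the zeros at the end points (as long as
  \<open>k < n\<close>) and creates a zero strictly between any two neighbouring zeros.\<close>

lemma rodrigues_roots:
  assumes "k \<le> n"
  shows "\<exists>x :: nat \<Rightarrow> real.
           (\<forall>i<k. -1 < x i \<and> x i < 1 \<and> poly ((pderiv ^^ k) ([:-1, 0, 1:] ^ n)) (x i) = 0)
           \<and> (\<forall>i. Suc i < k \<longrightarrow> x i < x (Suc i))"
  using assms
proof (induction k)
  case (Suc k)
  let ?p = "(pderiv ^^ k) ([:-1, 0, 1:] ^ n) :: real poly"
  obtain x where x: "\<And>i. i < k \<Longrightarrow> -1 < x i \<and> x i < 1 \<and> poly ?p (x i) = 0"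
    and mono: "\<And>i. Suc i < k \<Longrightarrow> x i < x (Suc i)"
    using Suc by fastforce
  \<comment> \<open>Indices 0 and \<open>k + 1\<close> are the end points, with the old zeros at 1
    to \<open>k\<close> in between; Rolle on the \<open>k + 1\<close> gaps yields the new
    zeros.\<close>
  define y where "y i = (if i = 0 then -1 else if i \<le> k then x (i - 1) else 1)" for i
  have y0: "poly ?p (y i) = 0" for i
    using rodrigues_vanishes_at_ends [of k n] Suc.prems x [of "i - 1"] by (auto simp: y_def)
  have y_bounds: "-1 \<le> y i" "y i \<le> 1" for i
    using x [of "i - 1"] by (auto simp: y_def intro: less_imp_le)
  have y_mono: "y i < y (Suc i)" if "i \<le> k" for i
    using x [of "i - 1"] x [of i] mono [of "i - 1"] that by (auto simp: y_def)
  have "\<exists>z. y i < z \<and> z < y (Suc i) \<and> poly (pderiv ?p) z = 0" if "i \<le> k" for i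
    using poly_MVT [OF y_mono [OF that], of ?p] y0 y_mono [OF that] by auto
  then obtain z where z: "\<And>i. i \<le> k \<Longrightarrow> y i < z i \<and> z i < y (Suc i) \<and> poly (pderiv ?p) (z i) = 0"
    by metis
  show ?case
  proof (intro exI [of _ z] conjI allI impI)
    fix i
    assume i: "i < Suc k"
    then show "-1 < z i" "z i < 1"
      using z [of i] y_bounds [of i] y_bounds [of "Suc i"] by auto
    show "poly ((pderiv ^^ Suc k) ([:-1, 0, 1:] ^ n)) (z i) = 0"
      using z [of i] i by simp
  next
    fix i
    assume "Suc i < Suc k"
    then show "z i < z (Suc i)"
      using z [of i] z [of "Suc i"] by auto
  qed
qed simp

lemma degree_legendre: "degree (legendre n) = n"
  by (simp add: legendre_def degree_pderiv_iterate degree_power_eq)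

lemma legendre_nonzero: "legendre n \<noteq> 0"
proof (cases "n = 0")
  case False
  then show ?thesis
    using degree_legendre [of n] by (metis degree_0)
qed (simp add: legendre_def)

text \<open>The \<open>n\<close> zeros of the \<open>n\<close>-th derivative, halved, are distinct
  members of this set. Hence the list lookup in \<open>gl_node\<close> stays in range.\<close>

lemma legendre_roots:
  shows "finite {x. poly (legendre n) (2 * x) = 0}"
    and "n \<le> card {x. poly (legendre n) (2 * x) = 0}"
proof -
  have "{x. poly (legendre n) (2 * x) = 0} = {x. poly (legendre n \<circ>\<^sub>p [:0, 2:]) x = 0}"
    by (simp add: poly_pcompose mult.commute)
  moreover have "legendre n \<circ>\<^sub>p [:0, 2:] \<noteq> 0"
    by (simp add: pcompose_eq_0_iff legendre_nonzero)
  ultimately show fin: "finite {x. poly (legendre n) (2 * x) = 0}"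
    using poly_roots_finite by simp
  obtain x :: "nat \<Rightarrow> real" where
      x: "\<And>i. i < n \<Longrightarrow> poly ((pderiv ^^ n) ([:-1, 0, 1:] ^ n)) (x i) = 0"
    and mono: "\<And>i. Suc i < n \<Longrightarrow> x i < x (Suc i)"
    using rodrigues_roots [of n n] by auto
  have "x i < x j" if "i < j" "j < n" for i j
    using that
  proof (induction j)
    case (Suc j)
    then show ?case
      using mono [of j] by (cases "i = j") auto
  qed simp
  then have "inj_on x {..<n}"
    by (metis (no_types, lifting) inj_onI lessThan_iff less_irrefl linorder_neqE_nat)
  then have "inj_on (\<lambda>i. x i / 2) {..<n}"
    by (simp add: inj_on_def)
  moreover have "(\<lambda>i. x i / 2) ` {..<n} \<subseteq> {x. poly (legendre n) (2 * x) = 0}"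
    using x by (auto simp: legendre_def)
  ultimately show "n \<le> card {x. poly (legendre n) (2 * x) = 0}"
    using card_inj_on_le [OF _ _ fin] by fastforce
qed

text \<open>Repeated integration by parts, phrased with antiderivatives.\<close>

lemma rodrigues_orthogonal:
  fixes g :: "real poly"
  assumes "k \<le> n" and "degree g < k"
  shows "\<exists>G. pderiv G = (pderiv ^^ k) ([:-1, 0, 1:] ^ n) * g \<and> poly G 1 = 0 \<and> poly G (-1) = 0"
  using assms
proof (induction k arbitrary: g)
  case (Suc k)
  let ?p = "(pderiv ^^ k) ([:-1, 0, 1:] ^ n) :: real poly"
  have "\<exists>H. pderiv H = ?p * pderiv g \<and> poly H 1 = 0 \<and> poly H (-1) = 0"
  \<comment> \<open>For constant \<open>g\<close> the induction hypothesis can fail to apply, since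
    it needs a degree below \<open>k\<close> and \<open>k\<close> may be 0; there
    \<open>H = 0\<close> serves.\<close>
  proof (cases "degree g = 0")
    case True
    then have "pderiv g = 0"
      by (simp add: pderiv_eq_0_iff)
    then show ?thesis
      by (intro exI [of _ 0]) simp
  next
    case False
    then show ?thesis
      using Suc by (intro Suc.IH) (auto simp: degree_pderiv)
  qed
  then obtain H where H: "pderiv H = ?p * pderiv g" "poly H 1 = 0" "poly H (-1) = 0"
    by blast
  \<comment> \<open>Integration by parts: \<open>?p * g\<close> is the boundary term, which vanishes
    at both ends because \<open>k < n\<close>.\<close>
  have "pderiv (?p * g - H) = (pderiv ^^ Suc k) ([:-1, 0, 1:] ^ n) * g"
    by (simp add: pderiv_diff pderiv_mult H(1) algebra_simps)
  moreover have "poly (?p * g - H) 1 = 0" "poly (?p * g - H) (-1) = 0"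
    using rodrigues_vanishes_at_ends [of k n] Suc.prems H by auto
  ultimately show ?case
    by blast
qed simp

lemma legendre_orthogonal:
  fixes h :: "real poly"
  assumes "degree h < n"
  shows "integral {-1/2..1/2} (poly ((legendre n \<circ>\<^sub>p [:0, 2:]) * h)) = 0"
proof -
  let ?p = "(pderiv ^^ n) ([:-1, 0, 1:] ^ n) :: real poly"
  let ?c = "1 / (2 ^ n * fact n) :: real"
  let ?g = "h \<circ>\<^sub>p [:0, 1/2:]"
  have "degree ?g < n"
    using assms by (simp add: degree_pcompose)
  then obtain G where G: "pderiv G = ?p * ?g" "poly G 1 = 0" "poly G (-1) = 0"
    using rodrigues_orthogonal [of n n ?g] by auto
  have gh: "?g \<circ>\<^sub>p [:0, 2:] = h"
    by (simp add: pcompose_assoc [symmetric] pcompose_pCons)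
  \<comment> \<open>The division by 2 offsets the chain-rule factor of x -> 2x; \<open>?c\<close> is
    the normalisation in Rodrigues' formula.\<close>
  let ?H = "Polynomial.smult (?c / 2) (G \<circ>\<^sub>p [:0, 2:])"
  have "pderiv ?H = (legendre n \<circ>\<^sub>p [:0, 2:]) * h"
    by (simp add: legendre_def pderiv_smult pderiv_pcompose G(1) pcompose_mult pcompose_smult gh
        pderiv_pCons)
  then show ?thesis
    using integral_poly_pderiv [of "-1/2" "1/2" ?H] G by (simp add: poly_pcompose)
qed

section \<open>Gauss-Legendre nodes and weights\<close>

lemma gl_node_root:
  assumes "i < N"
  shows "poly (legendre N) (2 * gl_node N i) = 0"
proof -
  let ?S = "{x. poly (legendre N) (2 * x) = 0}"
  have "gl_node N i \<in> set (sorted_list_of_set ?S)"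
    unfolding gl_node_def using legendre_roots [of N] assms by (intro nth_mem) simp
  then show ?thesis
    using legendre_roots(1) [of N] by simp
qed

lemma inj_on_gl_node: "inj_on (gl_node N) {..<N}"
proof -
  let ?xs = "sorted_list_of_set {x. poly (legendre N) (2 * x) = 0}"
  have "N \<le> length ?xs" "distinct ?xs"
    using legendre_roots [of N] by simp_all
  then show ?thesis
    unfolding gl_node_def by (auto simp: inj_on_def nth_eq_iff_index_eq)
qed

section \<open>The Lagrange basis\<close>

lemma poly_lagrange_node:
  assumes "i < N" and "j < N"
  shows "poly (lagrange N i) (gl_node N j) = (if i = j then 1 else 0)"
proof (cases "i = j")
  case True
  have "gl_node N i - gl_node N k \<noteq> 0" if "k \<in> {..<N} - {i}" for k
    using inj_on_gl_node [of N] that assms by (auto simp: inj_on_def)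
  then show ?thesis
    using True
    by (auto simp: lagrange_def poly_prod diff_divide_distrib [symmetric] intro!: prod.neutral)
next
  case False
  then show ?thesis
    using assms by (auto simp: lagrange_def poly_prod intro!: prod_zero)
qed

lemma degree_lagrange: "i < N \<Longrightarrow> degree (lagrange N i) < N"
proof -
  assume i: "i < N"
  have "degree (lagrange N i) \<le> degree (\<Prod>k \<in> {..<N} - {i}. [:- gl_node N k, 1:])"
    unfolding lagrange_def prod_smult by (rule degree_smult_le)
  also have "\<dots> < N"
    using i by (simp add: degree_prod_linear)
  finally show ?thesis .
qed

lemma poly_eqI_nodes:
  fixes p q :: "real poly"
  assumes "degree p < N" "degree q < N"
    and "\<And>i. i < N \<Longrightarrow> poly p (gl_node N i) = poly q (gl_node N i)"
  shows "p = q"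
  by (rule poly_eqI_degree [of "gl_node N ` {..<N}"])
    (use assms in \<open>auto simp: card_image inj_on_gl_node\<close>)

lemma degree_lagrange_sum:
  assumes "N > 0"
  shows "degree (\<Sum>i<N. Polynomial.smult (c i) (lagrange N i)) < N"
  using assms
  by (intro degree_sum_less) (auto intro: le_less_trans [OF degree_smult_le] degree_lagrange)

text \<open>Both sides have degree below \<open>N\<close> and take the value 1 at all
  \<open>N\<close> nodes.\<close>

lemma sum_lagrange:
  assumes "N > 0"
  shows "(\<Sum>i<N. lagrange N i) = 1"
proof (rule poly_eqI_nodes)
  show "degree (\<Sum>i<N. lagrange N i) < N"
    using degree_lagrange_sum [OF assms, of "\<lambda>_. 1"] by simp
qed (use assms in \<open>auto simp: poly_sum poly_lagrange_node\<close>)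

text \<open>Gauss quadrature integrates polynomials of degree at most \<open>2 N - 1\<close> exactly; here this
  is only needed for a polynomial that vanishes at all nodes.\<close>

lemma integral_eq_0_if_zero_at_nodes:
  fixes g :: "real poly"
  assumes "degree g < 2 * N" and "\<And>i. i < N \<Longrightarrow> poly g (gl_node N i) = 0"
  shows "integral {-1/2..1/2} (poly g) = 0"
proof (cases "g = 0")
  case False
  let ?L = "legendre N \<circ>\<^sub>p [:0, 2:]"
  let ?M = "\<Prod>x\<in>gl_node N ` {..<N}. [:- x, 1:]"
  have degM: "degree ?M = N"
    using degree_prod_linear [of "\<lambda>x. x" "gl_node N ` {..<N}"]
    by (simp add: card_image inj_on_gl_node)
  have L: "?L \<noteq> 0" "degree ?L = N"
    by (simp_all add: pcompose_eq_0_iff legendre_nonzero degree_pcompose degree_legendre)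
  \<comment> \<open>Both polynomials have degree \<open>N\<close>, so the cofactor is a nonzero
    constant. A multiple of \<open>?M\<close> is then one of \<open>?L\<close>, and orthogonality
    applies to \<open>g\<close>.\<close>
  have "?M dvd ?L"
    by (rule prod_linear_dvd) (auto simp: poly_pcompose mult.commute [of _ 2] gl_node_root)
  then obtain s where s: "?L = ?M * s"
    by (elim dvdE)
  have "degree s = 0"
    using L degM degree_mult_eq [of ?M s] unfolding s by auto
  then obtain c where c: "s = [:c:]"
    by (rule degree_eq_zeroE)
  have "c \<noteq> 0"
    using L(1) unfolding s c by auto
  have "?M dvd g"
    by (rule prod_linear_dvd) (use assms in auto)
  then obtain h where h: "g = ?M * h"
    by (elim dvdE)
  have "degree h < N"
    using assms(1) False degM degree_mult_eq [of ?M h] unfolding h by auto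
  then have "degree (Polynomial.smult (1 / c) h) < N"
    by (simp add: \<open>c \<noteq> 0\<close>)
  moreover have "g = ?L * Polynomial.smult (1 / c) h"
    unfolding s c h using \<open>c \<noteq> 0\<close> by simp
  ultimately show ?thesis
    using legendre_orthogonal by metis
qed (simp add: poly_0 [abs_def])

text \<open>The quadrature rule is exact for \<open>\<ell>\<^sub>i\<^sup>2\<close>, so \<open>\<omega>\<^sub>i = \<integral> \<ell>\<^sub>i = \<integral> \<ell>\<^sub>i\<^sup>2\<close>.\<close>

lemma gl_weight_nonzero:
  assumes "i < N"
  shows "gl_weight N i \<noteq> 0"
proof
  let ?l = "lagrange N i"
  assume "gl_weight N i = 0"
  \<comment> \<open>\<open>?l\<close> takes only the values 0 and 1 at the nodes, so this difference
    vanishes there.\<close>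
  have "degree (?l * ?l - ?l) < 2 * N"
  proof (rule degree_diff_less)
    show "degree (?l * ?l) < 2 * N"
      using degree_mult_le [of ?l ?l] degree_lagrange [OF assms] by linarith
    show "degree ?l < 2 * N"
      using degree_lagrange [OF assms] by linarith
  qed
  then have "integral {-1/2..1/2} (poly (?l * ?l - ?l)) = 0"
    by (rule integral_eq_0_if_zero_at_nodes) (simp add: poly_lagrange_node assms)
  moreover have "poly (?l * ?l - ?l) = (\<lambda>x. poly (?l * ?l) x - poly ?l x)"
    by auto
  ultimately have "integral {-1/2..1/2} (poly (?l * ?l)) = 0"
    using \<open>gl_weight N i = 0\<close> Henstock_Kurzweil_Integration.integral_diff
      [OF poly_integrable [of "?l * ?l" "-1/2" "1/2"] poly_integrable [of ?l]]
    by (simp add: gl_weight_def)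
  \<comment> \<open>A continuous nonnegative function with zero integral vanishes on the whole
    interval, which gives \<open>?l\<close> infinitely many zeros.\<close>
  moreover have "integral {-1/2..1/2} (poly (?l * ?l)) = 0
      \<longleftrightarrow> (\<forall>x\<in>{-1/2..1/2}. poly (?l * ?l) x = 0)"
    by (rule integral_eq_0_iff) (auto intro!: continuous_intros)
  ultimately have "{-1/2..1/2} \<subseteq> {x. poly ?l x = 0}"
    by auto
  moreover have "infinite {-1/2..1/2 :: real}"
    by (simp add: infinite_Icc)
  ultimately have "?l = 0"
    using poly_roots_finite finite_subset by blast
  then show False
    using poly_lagrange_node [OF assms assms] by simp
qed

section \<open>Operators\<close>

text \<open>A nonzero determinant makes the matrix a unit, so \<open>mat_inverse\<close> does not
  return \<open>None\<close> and \<open>the\<close> is meaningful.\<close>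

lemma inv_mat:
  assumes "A \<in> carrier_mat n n" and "det A \<noteq> 0"
  shows "inv_mat A \<in> carrier_mat n n" and "inv_mat A * A = 1\<^sub>m n"
proof -
  have "mat_inverse A \<noteq> None"
    using mat_inverse(1) [OF assms(1), of "()"] det_non_zero_imp_unit [OF assms, of "()"] by auto
  then have "mat_inverse A = Some (inv_mat A)"
    by (auto simp: inv_mat_def)
  from mat_inverse(2) [OF assms(1) this]
  show "inv_mat A \<in> carrier_mat n n" and "inv_mat A * A = 1\<^sub>m n"
    by auto
qed

lemma mass_mat_carrier [simp]: "mass_mat N \<in> carrier_mat N N"
  by (simp add: mass_mat_def)

lemma proj_mat_carrier [simp]: "proj_mat N \<in> carrier_mat N N"
  by (simp add: proj_mat_def)

lemma det_mass_mat: "det (mass_mat N) \<noteq> 0"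
proof -
  have "det (mass_mat N) = (\<Prod>i<N. gl_weight N i)"
    by (subst det_upper_triangular [OF _ mass_mat_carrier])
      (auto simp: mass_mat_def mat_diag_def diag_mat_def prod.list_conv_set_nth atLeast0LessThan)
  then show ?thesis
    using gl_weight_nonzero by simp
qed

text \<open>The diagonal matrix of reciprocals is a right inverse, and by associativity it coincides
  with the left inverse.\<close>

lemma inv_mass_mat: "inv_mat (mass_mat N) = mat_diag N (\<lambda>i. 1 / gl_weight N i)"
proof -
  let ?M = "mass_mat N" and ?W = "mat_diag N (\<lambda>i. 1 / gl_weight N i)"
  have "?M * ?W = 1\<^sub>m N"
    unfolding mass_mat_def mat_diag_mult_left [OF mat_diag_dim]
    by (rule eq_matI) (auto simp: mat_diag_def gl_weight_nonzero)
  moreover have "inv_mat ?M * (?M * ?W) = inv_mat ?M * ?M * ?W"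
    by (rule assoc_mult_mat [symmetric, OF inv_mat(1) [OF mass_mat_carrier det_mass_mat]
          mass_mat_carrier mat_diag_dim])
  ultimately show ?thesis
    using inv_mat [OF mass_mat_carrier det_mass_mat, of N] left_mult_one_mat [OF mat_diag_dim]
    by simp
qed

text \<open>If \<open>P v = 0\<close> then an antiderivative of \<open>\<Sum> v\<^sub>j \<ell>\<^sub>j\<close> has degree at most \<open>N\<close> and takes the
  same value at all \<open>N + 1\<close> subcell faces, so it is constant.\<close>

lemma det_proj_mat:
  assumes "N > 0"
  shows "det (proj_mat N) \<noteq> 0"
proof
  assume "det (proj_mat N) = 0"
  then obtain v where v: "v \<in> carrier_vec N" "v \<noteq> 0\<^sub>v N" "proj_mat N *\<^sub>v v = 0\<^sub>v N"
    using det_0_iff_vec_prod_zero [OF proj_mat_carrier] by blast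
  define p where "p = (\<Sum>j<N. Polynomial.smult (v $ j) (lagrange N j))"
  obtain G where G: "pderiv G = p"
    by (rule pderiv_surj)
  have mono: "subcell_face N i < subcell_face N j" if "i < j" for i j
    using that assms by (simp add: subcell_face_def divide_strict_right_mono)
  \<comment> \<open>Entry \<open>i\<close> of P v is \<open>N\<close> times the integral of
    \<open>p\<close> over subcell \<open>i\<close>, hence \<open>N\<close> times an increment of
    \<open>G\<close>.\<close>
  have step: "poly G (subcell_face N (i + 1)) = poly G (subcell_face N i)" if "i < N" for i
  proof -
    let ?I = "{subcell_face N i..subcell_face N (i + 1)}"
    have "0 = (\<Sum>j<N. real N * integral ?I (poly (lagrange N j)) * v $ j)"
      using arg_cong [OF v(3), of "\<lambda>w. w $ i"] v(1) that
      by (simp add: proj_mat_def scalar_prod_def atLeast0LessThan)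
    also have "\<dots> = real N * (\<Sum>j<N. v $ j * integral ?I (poly (lagrange N j)))"
      by (simp add: sum_distrib_left algebra_simps)
    also have "(\<Sum>j<N. v $ j * integral ?I (poly (lagrange N j)))
        = integral ?I (\<lambda>x. \<Sum>j<N. v $ j * poly (lagrange N j) x)"
      by (subst integral_sum) (auto intro!: integrable_on_mult_right)
    also have "(\<lambda>x. \<Sum>j<N. v $ j * poly (lagrange N j) x) = poly p"
      by (auto simp: p_def poly_sum)
    also have "integral ?I (poly p) = poly G (subcell_face N (i + 1)) - poly G (subcell_face N i)"
      unfolding G [symmetric] using mono [of i "i + 1"] by (intro integral_poly_pderiv) simp
    finally show ?thesis
      using assms by simp
  qed
  let ?c = "poly G (subcell_face N 0)"
  have faces: "poly G (subcell_face N i) = ?c" if "i \<le> N" for i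
    using that by (induction i) (simp_all add: step [simplified])
  have "degree p < N"
    unfolding p_def by (rule degree_lagrange_sum [OF assms])
  have "G = [:?c:]"
  proof (rule poly_eqI_degree [of "subcell_face N ` {..N}"])
    have "inj_on (subcell_face N) {..N}"
      using mono by (metis inj_onI less_irrefl linorder_neqE_nat)
    then have "card (subcell_face N ` {..N}) = Suc N"
      by (simp add: card_image)
    moreover have "degree G \<le> N"
      using \<open>degree p < N\<close> unfolding G [symmetric] degree_pderiv by simp
    ultimately show "degree G < card (subcell_face N ` {..N})"
      "degree [:?c:] < card (subcell_face N ` {..N})"
      by simp_all
  next
    fix x
    assume "x \<in> subcell_face N ` {..N}"
    then obtain i where "i \<le> N" "x = subcell_face N i"
      by auto
    then show "poly G x = poly [:?c:] x"
      using faces [of i] by simp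
  qed
  then have "p = 0"
    using G by (metis degree_pCons_0 pderiv_eq_0_iff)
  \<comment> \<open>Evaluating \<open>p\<close> at node \<open>i\<close> reads off the coefficient
    \<open>v $ i\<close>.\<close>
  have "v $ i = 0" if "i < N" for i
  proof -
    have "poly p (gl_node N i) = (\<Sum>j<N. if j = i then v $ j else 0)"
      unfolding p_def poly_sum by (rule sum.cong) (use that in \<open>auto simp: poly_lagrange_node\<close>)
    then show ?thesis
      using \<open>p = 0\<close> that by simp
  qed
  then have "v = 0\<^sub>v N"
    using v(1) by (intro eq_vecI) auto
  then show False
    using v(2) by contradiction
qed

section \<open>Column sums under the projection\<close>

lemma sum_integral_subcells:
  fixes p :: "real poly"
  assumes "N > 0"
  shows "(\<Sum>i<N. integral {subcell_face N i..subcell_face N (i + 1)} (poly p))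
           = integral {-1/2..1/2} (poly p)"
proof -
  obtain G where G: "pderiv G = p"
    by (rule pderiv_surj)
  have "subcell_face N i \<le> subcell_face N (i + 1)" for i
    using assms by (simp add: subcell_face_def divide_right_mono)
  then have "(\<Sum>i<N. integral {subcell_face N i..subcell_face N (i + 1)} (poly p))
      = (\<Sum>i<N. poly G (subcell_face N (Suc i)) - poly G (subcell_face N i))"
    unfolding G [symmetric] by (simp add: integral_poly_pderiv)
  also have "\<dots> = poly G (1/2) - poly G (-1/2)"
    using assms by (subst sum_lessThan_telescope) (simp add: subcell_face_def)
  also have "\<dots> = integral {-1/2..1/2} (poly p)"
    unfolding G [symmetric] by (simp add: integral_poly_pderiv)
  finally show ?thesis .
qed

lemma col_sum_proj_mat:
  assumes "N > 0" and "j < N"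
  shows "(\<Sum>i<N. proj_mat N $$ (i, j)) = real N * gl_weight N j"
proof -
  have "(\<Sum>i<N. proj_mat N $$ (i, j))
      = real N * (\<Sum>i<N. integral {subcell_face N i..subcell_face N (i + 1)} (poly (lagrange N j)))"
    unfolding sum_distrib_left by (rule sum.cong) (use assms in \<open>auto simp: proj_mat_def\<close>)
  then show ?thesis
    unfolding sum_integral_subcells [OF assms(1)] gl_weight_def .
qed

lemma ones_mult_mat_vec:
  assumes "A \<in> carrier_mat n m" and "v \<in> carrier_vec m"
  shows "ones n \<bullet> (A *\<^sub>v v) = (\<Sum>j<m. (\<Sum>i<n. A $$ (i, j)) * v $ j)"
proof -
  have "ones n \<bullet> (A *\<^sub>v v) = (\<Sum>i<n. \<Sum>j<m. A $$ (i, j) * v $ j)"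
    using assms by (simp add: ones_def scalar_prod_def atLeast0LessThan)
  then show ?thesis
    by (subst (asm) sum.swap) (simp add: sum_distrib_right)
qed

text \<open>Reduces column sums of P A to those of A weighted by the quadrature weights; used with
  \<open>dg_vol N\<close> and \<open>dg_surf N\<close> as A.\<close>

lemma ones_proj_mat_mult:
  assumes "N > 0" and "A \<in> carrier_mat N m" and "v \<in> carrier_vec m"
  shows "ones N \<bullet> (proj_mat N * A *\<^sub>v v)
           = real N * (\<Sum>j<m. (\<Sum>k<N. gl_weight N k * A $$ (k, j)) * v $ j)"
proof -
  have "ones N \<bullet> (proj_mat N * A *\<^sub>v v) = ones N \<bullet> (proj_mat N *\<^sub>v (A *\<^sub>v v))"
    using assms by (subst assoc_mult_mat_vec [OF proj_mat_carrier]) auto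
  also have "\<dots> = (\<Sum>k<N. real N * gl_weight N k * (\<Sum>j<m. A $$ (k, j) * v $ j))"
    using assms
    by (subst ones_mult_mat_vec [OF proj_mat_carrier])
      (auto simp: col_sum_proj_mat scalar_prod_def atLeast0LessThan)
  also have "\<dots> = (\<Sum>j<m. \<Sum>k<N. real N * gl_weight N k * (A $$ (k, j) * v $ j))"
    unfolding sum_distrib_left by (rule sum.swap)
  finally show ?thesis
    by (simp add: sum_distrib_left sum_distrib_right mult.assoc)
qed

section \<open>Balances of the difference, volume and surface operators\<close>

lemma ones_fv_diff:
  assumes "w \<in> carrier_vec (N + 1)"
  shows "ones N \<bullet> (fv_diff N *\<^sub>v w) = w $ N - w $ 0"
proof -
  have "(fv_diff N *\<^sub>v w) $ i = w $ Suc i - w $ i" if "i < N" for i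
  proof -
    have "(fv_diff N *\<^sub>v w) $ i
        = (\<Sum>j<N + 1. (if j = i then - w $ j else 0) + (if j = i + 1 then w $ j else 0))"
      using assms that
      by (auto simp: fv_diff_def scalar_prod_def atLeast0LessThan intro!: sum.cong)
    then show ?thesis
      using that by (simp add: sum.distrib)
  qed
  moreover have "ones N \<bullet> (fv_diff N *\<^sub>v w) = (\<Sum>i<N. (fv_diff N *\<^sub>v w) $ i)"
    by (simp add: ones_def scalar_prod_def atLeast0LessThan fv_diff_def)
  ultimately show ?thesis
    by (simp add: sum_lessThan_telescope)
qed

lemma dg_vol_carrier [simp]: "dg_vol N \<in> carrier_mat N N"
  unfolding dg_vol_def inv_mass_mat
  by (intro mult_carrier_mat [of _ N N] mat_diag_dim mass_mat_carrier) (simp add: nodal_diff_def)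

text \<open>The transpose attaches the basis polynomial to the row index \<open>k\<close>, so a sum
  over \<open>k\<close> later acts on the basis itself.\<close>

lemma dg_vol_entry:
  assumes "k < N" and "j < N"
  shows "dg_vol N $$ (k, j)
           = 1 / gl_weight N k * poly (pderiv (lagrange N k)) (gl_node N j) * gl_weight N j"
proof -
  have "transpose_mat (nodal_diff N) \<in> carrier_mat N N"
    by (simp add: nodal_diff_def)
  then have "dg_vol N = mat N N (\<lambda>(i, j). mat N N (\<lambda>(i, j).
      1 / gl_weight N i * transpose_mat (nodal_diff N) $$ (i, j)) $$ (i, j) * gl_weight N j)"
    unfolding dg_vol_def inv_mass_mat
    by (simp add: mass_mat_def mat_diag_mult_left [of _ N N] mat_diag_mult_right [of _ N])
  then show ?thesis
    using assms by (simp add: nodal_diff_def)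
qed

text \<open>Once the weights of the rows cancel, each column sum contains the derivative of the
  constant 1.\<close>

lemma ones_D_hat:
  assumes "N > 0" and "v \<in> carrier_vec N"
  shows "ones N \<bullet> (D_hat N *\<^sub>v v) = 0"
proof -
  have "(\<Sum>k<N. gl_weight N k * dg_vol N $$ (k, j)) = 0" if "j < N" for j
  proof -
    have "(\<Sum>k<N. gl_weight N k * dg_vol N $$ (k, j))
        = (\<Sum>k<N. poly (pderiv (lagrange N k)) (gl_node N j) * gl_weight N j)"
      using that by (intro sum.cong) (auto simp: dg_vol_entry gl_weight_nonzero)
    also have "\<dots> = poly (pderiv (\<Sum>k<N. lagrange N k)) (gl_node N j) * gl_weight N j"
      by (simp add: pderiv_sum poly_sum sum_distrib_right)
    finally show ?thesis
      by (simp add: sum_lagrange assms)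
  qed
  then show ?thesis
    using assms by (simp add: D_hat_def ones_proj_mat_mult [of _ _ N])
qed

lemma ones_B_hat:
  assumes "N > 0" and "w \<in> carrier_vec (N + 1)"
  shows "ones N \<bullet> (B_hat N *\<^sub>v w) = real N * (w $ N - w $ 0)"
proof -
  have one: "(\<Sum>k<N. poly (lagrange N k) x) = 1" for x
    using arg_cong [OF sum_lagrange [OF assms(1)], of "\<lambda>p. poly p x"] by (simp add: poly_sum)
  have "(\<Sum>k<N. gl_weight N k * dg_surf N $$ (k, j))
      = (if j = 0 then -1 else if j = N then 1 else 0)"
    if "j < N + 1" for j
  proof -
    have "(\<Sum>k<N. gl_weight N k * dg_surf N $$ (k, j))
        = (\<Sum>k<N. if j = 0 then - poly (lagrange N k) (-1/2)
                   else if j = N then poly (lagrange N k) (1/2) else 0)"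
      using that by (intro sum.cong) (auto simp: dg_surf_def gl_weight_nonzero)
    then show ?thesis
      by (simp add: sum_negf one)
  qed
  moreover have "dg_surf N \<in> carrier_mat N (N + 1)"
    by (simp add: dg_surf_def)
  ultimately have "ones N \<bullet> (B_hat N *\<^sub>v w)
      = real N * (\<Sum>j<N + 1. (if j = 0 then -1 else if j = N then 1 else 0) * w $ j)"
    unfolding B_hat_def using assms by (subst ones_proj_mat_mult) auto
  \<comment> \<open>\<open>N > 0\<close> keeps the columns 0 and \<open>N\<close> distinct, so the
    nested cases become a sum.\<close>
  also have "(\<Sum>j<N + 1. (if j = 0 then -1 else if j = N then 1 else 0) * w $ j)
      = (\<Sum>j<N + 1. (if j = 0 then - w $ j else 0) + (if j = N then w $ j else 0))"
    using assms by (intro sum.cong) auto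
  finally show ?thesis
    by (simp add: sum.distrib)
qed

section \<open>Conservation\<close>

text \<open>The length is the row count of \<open>rec_mat N\<close>, which is known because P is
  nonsingular.\<close>

lemma volume_flux_carrier:
  assumes "N > 0"
  shows "volume_flux N f b v \<in> carrier_vec N"
proof (rule carrier_vecI)
  show "dim_vec (volume_flux N f b v) = N"
    using carrier_matD(1) [OF inv_mat(1) [OF proj_mat_carrier det_proj_mat [OF assms]]]
    by (simp add: volume_flux_def nodal_values_def limited_rec_mat_def rec_mat_def)
qed

lemma surface_flux_carrier: "surface_flux N Q fs \<alpha> \<beta> uL uR u q \<in> carrier_vec (N + 1)"
  by (simp add: surface_flux_def)

text \<open>The volume term sums to zero, and the difference and surface terms both give the same
  multiple of the flux jump; the factors \<open>1 - \<alpha> q\<close> and \<open>\<alpha> q\<close>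
  add up to 1, so the blending drops out.\<close>

lemma element_balance:
  assumes "N > 0" and "dx q \<noteq> 0"
  shows "dx q * (ones N \<bullet> blended_rhs N Q dx f fs \<alpha> \<beta> uL uR u q)
           = - real N * (surface_flux N Q fs \<alpha> \<beta> uL uR u q $ N
                         - surface_flux N Q fs \<alpha> \<beta> uL uR u q $ 0)"
proof -
  let ?w = "surface_flux N Q fs \<alpha> \<beta> uL uR u q" and ?v = "volume_flux N f (\<beta> q) (u q)"
  have w: "?w \<in> carrier_vec (N + 1)" and v: "?v \<in> carrier_vec N"
    by (rule surface_flux_carrier, rule volume_flux_carrier [OF assms(1)])
  have c: "ones N \<in> carrier_vec N" "fv_diff N *\<^sub>v ?w \<in> carrier_vec N"
    "D_hat N *\<^sub>v ?v \<in> carrier_vec N" "B_hat N *\<^sub>v ?w \<in> carrier_vec N"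
    by (rule carrier_vecI, simp add: ones_def fv_diff_def D_hat_def B_hat_def proj_mat_def)+
  have rhs: "ones N \<bullet> blended_rhs N Q dx f fs \<alpha> \<beta> uL uR u q
      = (1 - \<alpha> q) * (- real N / dx q) * (ones N \<bullet> (fv_diff N *\<^sub>v ?w))
        + \<alpha> q * (1 / dx q) * (ones N \<bullet> (D_hat N *\<^sub>v ?v) - ones N \<bullet> (B_hat N *\<^sub>v ?w))"
    unfolding blended_rhs_def using c
    by (simp add: scalar_prod_add_distrib [of _ N] scalar_prod_minus_distrib [of _ N])
  show ?thesis
    unfolding rhs ones_fv_diff [OF w] ones_D_hat [OF assms(1) v] ones_B_hat [OF assms(1) w]
    using assms(2) by (simp add: field_simps)
qed

text \<open>Neighbouring elements see the same pair of states at their shared face, so the interface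
  flux is single valued.\<close>

lemma surface_flux_interface:
  assumes "N > 0"
  shows "surface_flux N Q fs \<alpha> \<beta> uL uR u (Suc q) $ 0
           = fs (face_plus N \<alpha> \<beta> uL u q) (face_minus N Q \<alpha> \<beta> uR u q)"
    and "surface_flux N Q fs \<alpha> \<beta> uL uR u q $ N
           = fs (face_plus N \<alpha> \<beta> uL u q) (face_minus N Q \<alpha> \<beta> uR u q)"
  using assms by (simp_all add: surface_flux_def states_plus_def states_minus_def)

text \<open>The periodicity equations are not circular: as \<open>Q\<close> is positive,
  \<open>face_plus\<close> at \<open>Q\<close> does not depend on \<open>uL\<close>, nor
  \<open>face_minus\<close> at 0 on \<open>uR\<close>.\<close>

theorem mainTheorem1:
  fixes N Q r :: nat
    and dx \<alpha> \<beta> :: "nat \<Rightarrow> real"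
    and f :: "real \<Rightarrow> real"
    and fs :: "real \<Rightarrow> real \<Rightarrow> real"
    and uL uR :: real
    and u :: "nat \<Rightarrow> real vec"
  assumes "r \<ge> 1" and "N = 2 ^ r" and "Q \<ge> 1"
    and "\<And>q. q \<in> {1..Q} \<Longrightarrow> dx q > 0"
    and "\<And>q. q \<in> {1..Q} \<Longrightarrow> 0 \<le> \<beta> q \<and> \<beta> q \<le> 1"
    and "consistent_flux f fs"
    and "\<And>q. q \<in> {1..Q} \<Longrightarrow> u q \<in> carrier_vec N"
  shows "(\<Sum>q = 1..Q. dx q * (ones N \<bullet> blended_rhs N Q dx f fs \<alpha> \<beta> uL uR u q))
           = - real N * (- (surface_flux N Q fs \<alpha> \<beta> uL uR u 1 $ 0)
                         + surface_flux N Q fs \<alpha> \<beta> uL uR u Q $ N)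
    \<and> (uL = face_plus N \<alpha> \<beta> uL u Q \<and> uR = face_minus N Q \<alpha> \<beta> uR u 0 \<longrightarrow>
           - (surface_flux N Q fs \<alpha> \<beta> uL uR u 1 $ 0)
             + surface_flux N Q fs \<alpha> \<beta> uL uR u Q $ N = 0
           \<and> (\<Sum>q = 1..Q. dx q * (ones N \<bullet> blended_rhs N Q dx f fs \<alpha> \<beta> uL uR u q)) = 0)"
proof -
  let ?w = "surface_flux N Q fs \<alpha> \<beta> uL uR u"
  let ?F = "\<lambda>q. fs (face_plus N \<alpha> \<beta> uL u q) (face_minus N Q \<alpha> \<beta> uR u q)"
  have N: "N > 0"
    using assms(2) by simp
  have left: "?w (Suc q) $ 0 = ?F q" and right: "?w q $ N = ?F q" for q
    by (rule surface_flux_interface [OF N])+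
  \<comment> \<open>Element \<open>q\<close> lies between the interfaces \<open>q - 1\<close> and
    \<open>q\<close>; the truncated subtraction is harmless as \<open>q\<close> is at least
    1.\<close>
  have "dx q * (ones N \<bullet> blended_rhs N Q dx f fs \<alpha> \<beta> uL uR u q) = - real N * (?F q - ?F (q - 1))"
    if "q \<in> {1..Q}" for q
    using element_balance [OF N, of dx q Q f fs \<alpha> \<beta> uL uR u] assms(4) [OF that] that
      left [of "q - 1"] right [of q] by simp
  then have "(\<Sum>q = 1..Q. dx q * (ones N \<bullet> blended_rhs N Q dx f fs \<alpha> \<beta> uL uR u q))
      = - real N * (\<Sum>q = 1..Q. ?F q - ?F (q - 1))"
    by (simp add: sum_distrib_left)
  also have "(\<Sum>q = 1..Q. ?F q - ?F (q - 1)) = ?F Q - ?F 0"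
    by (simp add: sum.atLeast1_atMost_eq sum_lessThan_telescope [of ?F])
  also have "?F Q - ?F 0 = - (?w 1 $ 0) + ?w Q $ N"
    using left [of 0] right [of Q] by simp
  finally have main: "(\<Sum>q = 1..Q. dx q * (ones N \<bullet> blended_rhs N Q dx f fs \<alpha> \<beta> uL uR u q))
      = - real N * (- (?w 1 $ 0) + ?w Q $ N)" .
  have "- (?w 1 $ 0) + ?w Q $ N = 0"
    if "uL = face_plus N \<alpha> \<beta> uL u Q" "uR = face_minus N Q \<alpha> \<beta> uR u 0"
  proof -
    \<comment> \<open>Under periodicity the interfaces 0 and \<open>Q\<close> pass the same two
      states to \<open>fs\<close>.\<close>
    have "?F 0 = fs uL (face_minus N Q \<alpha> \<beta> uR u 0)" "?F Q = fs (face_plus N \<alpha> \<beta> uL u Q) uR"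
      by (simp_all add: face_plus_def face_minus_def)
    then have "?F 0 = ?F Q"
      using that by simp
    then show ?thesis
      using left [of 0] right [of Q] by simp
  qed
  with main show ?thesis
    by simp
qed

end
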